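(* Let $A\subseteq(0,1)$ be countable with set of limit points in $[0,1]$ equal to $A'=\{0\}$. In the Gödel logic $\mathfrak{G}_{[0,1],A}$, every strongly consistent $\mathcal{L}$-theory is contained in a maximally strongly consistent, deductively Henkin $\mathcal{L}'$-theory for some first-order language $\mathcal{L}'\supseteq\mathcal{L}$.
   Context: The logic $\mathfrak{G}_{[0,1],A}$ over a first-order language $\mathcal{L}$ has connectives $\wedge,\to,\bot$, quantifiers $\forall,\exists$, and nullary connectives $\bar r$ for $r\in A$ ($\bar1$ is $\bot$, $\bar0$ available). Abbreviations: $\neg\varphi:=\varphi\to\bot$, $\varphi\vee\psi:=((\varphi\to\psi)\to\psi)\wedge((\psi\to\varphi)\to\varphi)$, $\varphi\leftrightarrow\psi:=(\varphi\to\psi)\wedge(\psi\to\varphi)$. Proof system: axioms (G1) $(\varphi\to\psi)\to((\psi\to\chi)\to(\varphi\to\chi))$; (G2) $(\varphi\wedge\psi)\to\varphi$; (G3) $(\varphi\wedge\psi)\to(\psi\wedge\varphi)$; (G4) $\varphi\to(\varphi\wedge\varphi)$; (G5) $(\varphi\to(\psi\to\chi))\leftrightarrow((\varphi\wedge\psi)\to\chi)$; (G6) $((\varphi\to\psi)\to\chi)\to(((\psi\to\varphi)\to\chi)\to\chi)$; (G7) $\bar1\to\varphi$; (G$\forall$1) $\forall x\varphi(x)\to\varphi(t)$; (G$\forall$2) $\forall x(\psi\to\varphi(x))\to(\psi\to\forall x\varphi(x))$, $x$ not free in $\psi$; (G$\forall$3) $\forall x(\psi\vee\varphi(x))\to(\psi\vee\forall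 x\varphi(x))$, $x$ not free in $\psi$; (G$\exists$1) $\varphi(t)\to\exists x\varphi(x)$; (G$\exists$2) $\forall x(\varphi(x)\to\psi)\to(\exists x\varphi(x)\to\psi)$, $x$ not free in $\psi$ ($t$ substitutable); for $r,s\in A\cup\{0,1\}$: (RG1) $(\bar r\wedge\bar s)\leftrightarrow\overline{\max\{r,s\}}$; (RG2a) $\bar r\to\bar s$ for $r\ge s$; (RG2b) $(\bar r\to\bar s)\leftrightarrow\bar s$ for $r<s$; (RG3) $\neg\neg\bar r$ for $r<1$; rules modus ponens and generalization. $T\vdash\varphi$ means a finite derivation from $T$ and the axioms; theories are sets of sentences. $T$ is strongly consistent if $T\nvdash\bar r$ for every $r\in A\cup\{1\}$; an $\mathcal L'$-theory is maximally strongly consistent if it is strongly consistent and no $\mathcal L'$-theory properly containing it is strongly consistent. An $\mathcal L'$-theory $T$ is deductively Henkin if for every $\mathcal L'$-sentence $\forall x\,\varphi(x)$ with $T\nvdash\forall x\,\varphi(x)$ there is a constant symbol $c$ of $\mathcal L'$ with $T\nvdash\varphi(c)$. *)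

theory Defs
  imports "HOL-Analysis.Analysis"
begin

text \<open>A symbol of a language is a name together with its arity; the constant symbols are the
  function symbols of arity 0.\<close>

record ('f, 'p) lang =
  Funs :: "('f \<times> nat) set"
  Preds :: "('p \<times> nat) set"

datatype 'f tm = Var nat | Fn 'f "'f tm list"

datatype ('f, 'p) fm =
    Bot
  | Const real
  | Rel 'p "'f tm list"
  | And "('f, 'p) fm" "('f, 'p) fm" (infixr "\<^bold>\<and>" 65)
  | Imp "('f, 'p) fm" "('f, 'p) fm" (infixr "\<^bold>\<longrightarrow>" 60)
  | All nat "('f, 'p) fm"
  | Ex nat "('f, 'p) fm"

abbreviation Neg :: "('f, 'p) fm \<Rightarrow> ('f, 'p) fm" where
  "Neg \<phi> \<equiv> \<phi> \<^bold>\<longrightarrow> Bot"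

abbreviation Or :: "('f, 'p) fm \<Rightarrow> ('f, 'p) fm \<Rightarrow> ('f, 'p) fm" (infixr "\<^bold>\<or>" 64) where
  "\<phi> \<^bold>\<or> \<psi> \<equiv> ((\<phi> \<^bold>\<longrightarrow> \<psi>) \<^bold>\<longrightarrow> \<psi>) \<^bold>\<and> ((\<psi> \<^bold>\<longrightarrow> \<phi>) \<^bold>\<longrightarrow> \<phi>)"

abbreviation Iff :: "('f, 'p) fm \<Rightarrow> ('f, 'p) fm \<Rightarrow> ('f, 'p) fm" (infix "\<^bold>\<longleftrightarrow>" 59) where
  "\<phi> \<^bold>\<longleftrightarrow> \<psi> \<equiv> (\<phi> \<^bold>\<longrightarrow> \<psi>) \<^bold>\<and> (\<psi> \<^bold>\<longrightarrow> \<phi>)"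

text \<open>The truth constant of a value \<open>r \<in> A \<union> {0, 1}\<close>, where \<open>A \<subseteq> {0<..<1}\<close>. Only the values in
  \<open>A\<close> have a nullary connective of their own (see \<open>wf_fm\<close>). In this logic 0 is absolute truth and
  1 is absolute falsity, so the constant of 1 is \<open>Bot\<close> and that of 0 is \<open>Bot \<^bold>\<longrightarrow> Bot\<close>.\<close>

definition tconst :: "real \<Rightarrow> ('f, 'p) fm" where
  "tconst r = (if r = 1 then Bot else if r = 0 then Bot \<^bold>\<longrightarrow> Bot else Const r)"

primrec wf_tm :: "('f, 'p) lang \<Rightarrow> 'f tm \<Rightarrow> bool" where
  "wf_tm L (Var x) \<longleftrightarrow> True"
| "wf_tm L (Fn f ts) \<longleftrightarrow> (f, length ts) \<in> Funs L \<and> list_all (wf_tm L) ts"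

primrec wf_fm :: "real set \<Rightarrow> ('f, 'p) lang \<Rightarrow> ('f, 'p) fm \<Rightarrow> bool" where
  "wf_fm A L Bot \<longleftrightarrow> True"
| "wf_fm A L (Const r) \<longleftrightarrow> r \<in> A"
| "wf_fm A L (Rel p ts) \<longleftrightarrow> (p, length ts) \<in> Preds L \<and> list_all (wf_tm L) ts"
| "wf_fm A L (\<phi> \<^bold>\<and> \<psi>) \<longleftrightarrow> wf_fm A L \<phi> \<and> wf_fm A L \<psi>"
| "wf_fm A L (\<phi> \<^bold>\<longrightarrow> \<psi>) \<longleftrightarrow> wf_fm A L \<phi> \<and> wf_fm A L \<psi>"
| "wf_fm A L (All x \<phi>) \<longleftrightarrow> wf_fm A L \<phi>"
| "wf_fm A L (Ex x \<phi>) \<longleftrightarrow> wf_fm A L \<phi>"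

primrec fv_tm :: "'f tm \<Rightarrow> nat set" where
  "fv_tm (Var x) = {x}"
| "fv_tm (Fn f ts) = \<Union> (set (map fv_tm ts))"

primrec fv :: "('f, 'p) fm \<Rightarrow> nat set" where
  "fv Bot = {}"
| "fv (Const r) = {}"
| "fv (Rel p ts) = \<Union> (set (map fv_tm ts))"
| "fv (\<phi> \<^bold>\<and> \<psi>) = fv \<phi> \<union> fv \<psi>"
| "fv (\<phi> \<^bold>\<longrightarrow> \<psi>) = fv \<phi> \<union> fv \<psi>"
| "fv (All x \<phi>) = fv \<phi> - {x}"
| "fv (Ex x \<phi>) = fv \<phi> - {x}"

definition sentence :: "real set \<Rightarrow> ('f, 'p) lang \<Rightarrow> ('f, 'p) fm \<Rightarrow> bool" where
  "sentence A L \<phi> \<longleftrightarrow> wf_fm A L \<phi> \<and> fv \<phi> = {}"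

text \<open>\<open>subst \<phi> x t\<close> replaces the free occurrences of \<open>x\<close> without renaming bound variables; capture
  is excluded by \<open>substitutable t x \<phi>\<close>.\<close>

primrec subst_tm :: "'f tm \<Rightarrow> nat \<Rightarrow> 'f tm \<Rightarrow> 'f tm" where
  "subst_tm (Var y) x t = (if y = x then t else Var y)"
| "subst_tm (Fn f ts) x t = Fn f (map (\<lambda>u. subst_tm u x t) ts)"

primrec subst :: "('f, 'p) fm \<Rightarrow> nat \<Rightarrow> 'f tm \<Rightarrow> ('f, 'p) fm" where
  "subst Bot x t = Bot"
| "subst (Const r) x t = Const r"
| "subst (Rel p ts) x t = Rel p (map (\<lambda>u. subst_tm u x t) ts)"
| "subst (\<phi> \<^bold>\<and> \<psi>) x t = subst \<phi> x t \<^bold>\<and> subst \<psi> x t"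
| "subst (\<phi> \<^bold>\<longrightarrow> \<psi>) x t = subst \<phi> x t \<^bold>\<longrightarrow> subst \<psi> x t"
| "subst (All y \<phi>) x t = (if y = x then All y \<phi> else All y (subst \<phi> x t))"
| "subst (Ex y \<phi>) x t = (if y = x then Ex y \<phi> else Ex y (subst \<phi> x t))"

primrec substitutable :: "'f tm \<Rightarrow> nat \<Rightarrow> ('f, 'p) fm \<Rightarrow> bool" where
  "substitutable t x Bot \<longleftrightarrow> True"
| "substitutable t x (Const r) \<longleftrightarrow> True"
| "substitutable t x (Rel p ts) \<longleftrightarrow> True"
| "substitutable t x (\<phi> \<^bold>\<and> \<psi>) \<longleftrightarrow> substitutable t x \<phi> \<and> substitutable t x \<psi>"
| "substitutable t x (\<phi> \<^bold>\<longrightarrow> \<psi>) \<longleftrightarrow> substitutable t x \<phi> \<and> substitutable t x \<psi>"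
| "substitutable t x (All y \<phi>) \<longleftrightarrow>
     (x \<in> fv \<phi> - {y} \<longrightarrow> y \<notin> fv_tm t \<and> substitutable t x \<phi>)"
| "substitutable t x (Ex y \<phi>) \<longleftrightarrow>
     (x \<in> fv \<phi> - {y} \<longrightarrow> y \<notin> fv_tm t \<and> substitutable t x \<phi>)"

inductive axiom :: "real set \<Rightarrow> ('f, 'p) fm \<Rightarrow> bool" for A :: "real set" where
  G1: "axiom A ((\<phi> \<^bold>\<longrightarrow> \<psi>) \<^bold>\<longrightarrow> ((\<psi> \<^bold>\<longrightarrow> \<theta>) \<^bold>\<longrightarrow> (\<phi> \<^bold>\<longrightarrow> \<theta>)))"
| G2: "axiom A ((\<phi> \<^bold>\<and> \<psi>) \<^bold>\<longrightarrow> \<phi>)"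
| G3: "axiom A ((\<phi> \<^bold>\<and> \<psi>) \<^bold>\<longrightarrow> (\<psi> \<^bold>\<and> \<phi>))"
| G4: "axiom A (\<phi> \<^bold>\<longrightarrow> (\<phi> \<^bold>\<and> \<phi>))"
| G5: "axiom A ((\<phi> \<^bold>\<longrightarrow> (\<psi> \<^bold>\<longrightarrow> \<theta>)) \<^bold>\<longleftrightarrow> ((\<phi> \<^bold>\<and> \<psi>) \<^bold>\<longrightarrow> \<theta>))"
| G6: "axiom A (((\<phi> \<^bold>\<longrightarrow> \<psi>) \<^bold>\<longrightarrow> \<theta>) \<^bold>\<longrightarrow> (((\<psi> \<^bold>\<longrightarrow> \<phi>) \<^bold>\<longrightarrow> \<theta>) \<^bold>\<longrightarrow> \<theta>))"
| G7: "axiom A (tconst 1 \<^bold>\<longrightarrow> \<phi>)"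
| GA1: "substitutable t x \<phi> \<Longrightarrow> axiom A (All x \<phi> \<^bold>\<longrightarrow> subst \<phi> x t)"
| GA2: "x \<notin> fv \<psi> \<Longrightarrow> axiom A (All x (\<psi> \<^bold>\<longrightarrow> \<phi>) \<^bold>\<longrightarrow> (\<psi> \<^bold>\<longrightarrow> All x \<phi>))"
| GA3: "x \<notin> fv \<psi> \<Longrightarrow> axiom A (All x (\<psi> \<^bold>\<or> \<phi>) \<^bold>\<longrightarrow> (\<psi> \<^bold>\<or> All x \<phi>))"
| GE1: "substitutable t x \<phi> \<Longrightarrow> axiom A (subst \<phi> x t \<^bold>\<longrightarrow> Ex x \<phi>)"
| GE2: "x \<notin> fv \<psi> \<Longrightarrow> axiom A (All x (\<phi> \<^bold>\<longrightarrow> \<psi>) \<^bold>\<longrightarrow> (Ex x \<phi> \<^bold>\<longrightarrow> \<psi>))"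
| RG1: "r \<in> A \<union> {0, 1} \<Longrightarrow> s \<in> A \<union> {0, 1} \<Longrightarrow>
          axiom A ((tconst r \<^bold>\<and> tconst s) \<^bold>\<longleftrightarrow> tconst (max r s))"
| RG2a: "r \<in> A \<union> {0, 1} \<Longrightarrow> s \<in> A \<union> {0, 1} \<Longrightarrow> r \<ge> s \<Longrightarrow>
          axiom A (tconst r \<^bold>\<longrightarrow> tconst s)"
| RG2b: "r \<in> A \<union> {0, 1} \<Longrightarrow> s \<in> A \<union> {0, 1} \<Longrightarrow> r < s \<Longrightarrow>
          axiom A ((tconst r \<^bold>\<longrightarrow> tconst s) \<^bold>\<longleftrightarrow> tconst s)"
| RG3: "r \<in> A \<union> {0, 1} \<Longrightarrow> r < 1 \<Longrightarrow> axiom A (Neg (Neg (tconst r)))"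

text \<open>Derivability within the language \<open>L\<close>: the \<open>wf_fm\<close> premises ensure that, for a set \<open>T\<close> of
  \<open>L\<close>-sentences, every formula of a derivation is an \<open>L\<close>-formula.\<close>

inductive deriv :: "real set \<Rightarrow> ('f, 'p) lang \<Rightarrow> ('f, 'p) fm set \<Rightarrow> ('f, 'p) fm \<Rightarrow> bool"
  for A :: "real set" and L :: "('f, 'p) lang" and T :: "('f, 'p) fm set" where
  Hyp: "\<phi> \<in> T \<Longrightarrow> deriv A L T \<phi>"
| Axm: "axiom A \<phi> \<Longrightarrow> wf_fm A L \<phi> \<Longrightarrow> deriv A L T \<phi>"
| MP: "deriv A L T \<phi> \<Longrightarrow> deriv A L T (\<phi> \<^bold>\<longrightarrow> \<psi>) \<Longrightarrow> deriv A L T \<psi>"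
| Gen: "deriv A L T \<phi> \<Longrightarrow> deriv A L T (All x \<phi>)"

definition theory_in :: "real set \<Rightarrow> ('f, 'p) lang \<Rightarrow> ('f, 'p) fm set \<Rightarrow> bool" where
  "theory_in A L T \<longleftrightarrow> (\<forall>\<phi>\<in>T. sentence A L \<phi>)"

definition strongly_consistent ::
    "real set \<Rightarrow> ('f, 'p) lang \<Rightarrow> ('f, 'p) fm set \<Rightarrow> bool" where
  "strongly_consistent A L T \<longleftrightarrow> (\<forall>r\<in>A \<union> {1}. \<not> deriv A L T (tconst r))"

definition maximally_strongly_consistent ::
    "real set \<Rightarrow> ('f, 'p) lang \<Rightarrow> ('f, 'p) fm set \<Rightarrow> bool" where
  "maximally_strongly_consistent A L T \<longleftrightarrow>
     strongly_consistent A L T \<and>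
     (\<forall>S. theory_in A L S \<and> T \<subset> S \<longrightarrow> \<not> strongly_consistent A L S)"

definition deductively_Henkin ::
    "real set \<Rightarrow> ('f, 'p) lang \<Rightarrow> ('f, 'p) fm set \<Rightarrow> bool" where
  "deductively_Henkin A L T \<longleftrightarrow>
     (\<forall>x \<phi>. sentence A L (All x \<phi>) \<and> \<not> deriv A L T (All x \<phi>) \<longrightarrow>
        (\<exists>c. (c, 0) \<in> Funs L \<and> \<not> deriv A L T (subst \<phi> x (Fn c []))))"

definition sublang :: "('f, 'p) lang \<Rightarrow> ('f, 'p) lang \<Rightarrow> bool" where
  "sublang L L' \<longleftrightarrow> Funs L \<subseteq> Funs L' \<and> Preds L \<subseteq> Preds L'"

text \<open>A language may use up all names of its type, so an extension takes its function symbols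
  from the type \<open>'f + ('f, 'p) fm\<close>: the old names, tagged by \<open>Inl\<close>, and as many further names as
  there are formulas. An \<open>L\<close>-theory becomes a theory over the larger type of names by tagging.\<close>

type_synonym ('f, 'p) ext_names = "'f + ('f, 'p) fm"

definition embed_lang :: "('f, 'p) lang \<Rightarrow> (('f, 'p) ext_names, 'p) lang" where
  "embed_lang L = \<lparr>Funs = {(Inl f, n) |f n. (f, n) \<in> Funs L}, Preds = Preds L\<rparr>"

definition embed_fm :: "('f, 'p) fm \<Rightarrow> (('f, 'p) ext_names, 'p) fm" where
  "embed_fm = map_fm Inl id"

end

theory Submission
  imports Defs
begin

text \<open>
  A maximally strongly consistent theory proves \<open>\<forall>x \<phi> \<rightarrow> r\<close> for some \<open>r \<in> A\<close> whenever it does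
  not prove \<open>\<forall>x \<phi>\<close>. Since 0 is a limit point of \<open>A\<close> there is \<open>s < r\<close> in \<open>A\<close>, and so the Henkin
  axioms \<open>(\<forall>x \<phi> \<rightarrow> r) \<rightarrow> (\<phi>(c) \<rightarrow> s)\<close> make \<open>\<phi>(c)\<close> underivable. These axioms are conservative for
  truth constants: if such an axiom implies \<open>t\<close> for a fresh \<open>c\<close>, hence for a variable in place of \<open>c\<close>,
  then prelinearity yields \<open>t \<or> (s \<rightarrow> \<phi>(x))\<close>, the quantifier shift \<open>t \<or> (s \<rightarrow> \<forall>x \<phi>)\<close>, and
  \<open>s \<rightarrow> \<forall>x \<phi>\<close> implies the axiom because \<open>(s \<rightarrow> r) \<rightarrow> r\<close>. Adding all Henkin axioms and applying
  Zorn's lemma gives the theory.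
\<close>

section \<open>Derivations\<close>

lemma deriv_wf:
  assumes "theory_in A L T" "deriv A L T \<phi>"
  shows "wf_fm A L \<phi>"
  using assms(2,1) by induction (auto simp: theory_in_def sentence_def)

lemma deriv_mono:
  assumes "deriv A L T \<phi>" "T \<subseteq> S"
  shows "deriv A L S \<phi>"
  using assms by induction (auto intro: deriv.intros)

text \<open>Compactness of derivability. It reduces consistency of all Henkin axioms together to
  finitely many of them, and consistency of the union of a chain to its members.\<close>

lemma deriv_finite:
  assumes "deriv A L T \<phi>"
  shows "\<exists>F. finite F \<and> F \<subseteq> T \<and> deriv A L F \<phi>"
  using assms
proof induction
  case (Hyp \<phi>)
  then show ?case by (intro exI[of _ "{\<phi>}"]) (auto intro: deriv.Hyp)
next
  case (Axm \<phi>)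
  then show ?case by (intro exI[of _ "{}"]) (auto intro: deriv.Axm)
next
  case (MP \<phi> \<psi>)
  then obtain F G where "finite F" "F \<subseteq> T" "deriv A L F \<phi>"
    "finite G" "G \<subseteq> T" "deriv A L G (\<phi> \<^bold>\<longrightarrow> \<psi>)" by blast
  then show ?case
    by (intro exI[of _ "F \<union> G"]) (auto intro: deriv.MP deriv_mono)
next
  case (Gen \<phi> x)
  then show ?case by (blast intro: deriv.Gen)
qed

lemma tconst_wf [simp]: "r \<in> A \<union> {1} \<Longrightarrow> wf_fm A L (tconst r)"
  by (auto simp: tconst_def)

lemma tconst_fv [simp]: "fv (tconst r) = {}"
  by (auto simp: tconst_def)

lemma tconst_subst [simp]: "subst (tconst r) x t = tconst r"
  by (auto simp: tconst_def)

lemma tconst_substitutable [simp]: "substitutable t x (tconst r)"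
  by (auto simp: tconst_def)

section \<open>Derived rules over a fixed theory\<close>

locale theory_context =
  fixes A :: "real set" and L :: "('f, 'p) lang" and T :: "('f, 'p) fm set"
  assumes theory_T: "theory_in A L T"
begin

abbreviation D :: "('f, 'p) fm \<Rightarrow> bool" where
  "D \<equiv> deriv A L T"

abbreviation W :: "('f, 'p) fm \<Rightarrow> bool" where
  "W \<equiv> wf_fm A L"

lemma D_wf: "D \<phi> \<Longrightarrow> W \<phi>"
  using deriv_wf theory_T by blast

lemma D_imp_wf:
  assumes "D (a \<^bold>\<longrightarrow> b)"
  shows "W a" "W b"
  using D_wf[OF assms] by auto

lemma syl:
  assumes "D (a \<^bold>\<longrightarrow> b)" "D (b \<^bold>\<longrightarrow> c)"
  shows "D (a \<^bold>\<longrightarrow> c)"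
proof -
  have "D ((a \<^bold>\<longrightarrow> b) \<^bold>\<longrightarrow> ((b \<^bold>\<longrightarrow> c) \<^bold>\<longrightarrow> (a \<^bold>\<longrightarrow> c)))"
    using assms D_wf by (fastforce intro: Axm G1)
  then show ?thesis using assms MP by blast
qed

lemma conjD1: "D (a \<^bold>\<and> b) \<Longrightarrow> D a"
  using D_wf by (fastforce intro: MP Axm G2)

lemma conjD2: "D (a \<^bold>\<and> b) \<Longrightarrow> D b"
  by (rule conjD1[of _ a], rule MP, assumption) (use D_wf in \<open>fastforce intro: Axm G3\<close>)

lemma curry: "D ((a \<^bold>\<and> b) \<^bold>\<longrightarrow> c) \<Longrightarrow> D (a \<^bold>\<longrightarrow> (b \<^bold>\<longrightarrow> c))"
  by (rule MP, assumption, rule conjD2, rule Axm, rule G5) (auto dest: D_wf)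

lemma uncurry: "D (a \<^bold>\<longrightarrow> (b \<^bold>\<longrightarrow> c)) \<Longrightarrow> D ((a \<^bold>\<and> b) \<^bold>\<longrightarrow> c)"
  by (rule MP, assumption, rule conjD1, rule Axm, rule G5) (auto dest: D_wf)

lemma contract: "D (a \<^bold>\<longrightarrow> (a \<^bold>\<longrightarrow> c)) \<Longrightarrow> D (a \<^bold>\<longrightarrow> c)"
  by (rule syl[OF Axm[OF G4] uncurry]) (auto dest: D_wf)

lemma permute: "D (a \<^bold>\<longrightarrow> (b \<^bold>\<longrightarrow> c)) \<Longrightarrow> D (b \<^bold>\<longrightarrow> (a \<^bold>\<longrightarrow> c))"
  by (rule curry, rule syl[OF Axm[OF G3] uncurry]) (auto dest: D_wf)

lemma K: "W a \<Longrightarrow> W b \<Longrightarrow> D (a \<^bold>\<longrightarrow> (b \<^bold>\<longrightarrow> a))"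
  by (rule curry, rule Axm, rule G2) simp

lemma weaken: "W a \<Longrightarrow> D b \<Longrightarrow> D (a \<^bold>\<longrightarrow> b)"
  using K MP D_wf by blast

lemma refl: "W a \<Longrightarrow> D (a \<^bold>\<longrightarrow> a)"
  by (rule contract, rule K)

text \<open>Chaining through the permuted implication leaves \<open>a\<close> twice as a premise;
  idempotence of conjunction (\<open>G4\<close>), in the form \<open>contract\<close>, merges the
  two copies.\<close>

lemma mp_under: "D (a \<^bold>\<longrightarrow> b) \<Longrightarrow> D (a \<^bold>\<longrightarrow> (b \<^bold>\<longrightarrow> c)) \<Longrightarrow> D (a \<^bold>\<longrightarrow> c)"
  by (rule contract, rule syl, assumption, rule permute)

lemma conjI_under:
  assumes "D (a \<^bold>\<longrightarrow> b)" "D (a \<^bold>\<longrightarrow> c)"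
  shows "D (a \<^bold>\<longrightarrow> (b \<^bold>\<and> c))"
proof -
  have "D (b \<^bold>\<longrightarrow> (c \<^bold>\<longrightarrow> (b \<^bold>\<and> c)))"
    using assms D_imp_wf by (intro curry refl) fastforce
  then show ?thesis
    using assms mp_under syl by blast
qed

lemma imp_imp: "W a \<Longrightarrow> W b \<Longrightarrow> D (a \<^bold>\<longrightarrow> ((a \<^bold>\<longrightarrow> b) \<^bold>\<longrightarrow> b))"
  by (rule permute, rule refl) simp

lemma orI1: "W a \<Longrightarrow> W b \<Longrightarrow> D (a \<^bold>\<longrightarrow> (a \<^bold>\<or> b))"
  by (intro conjI_under imp_imp K) auto

lemma orI2: "W a \<Longrightarrow> W b \<Longrightarrow> D (b \<^bold>\<longrightarrow> (a \<^bold>\<or> b))"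
  by (intro conjI_under imp_imp K) auto

text \<open>Prelinearity as a rule: any two formulas are comparable, so a proof may split on which
  implies the other.\<close>

lemma linear_cases:
  assumes "D ((a \<^bold>\<longrightarrow> b) \<^bold>\<longrightarrow> c)" "D ((b \<^bold>\<longrightarrow> a) \<^bold>\<longrightarrow> c)"
  shows "D c"
proof -
  have "D (((a \<^bold>\<longrightarrow> b) \<^bold>\<longrightarrow> c) \<^bold>\<longrightarrow> (((b \<^bold>\<longrightarrow> a) \<^bold>\<longrightarrow> c) \<^bold>\<longrightarrow> c))"
    using assms[THEN D_wf] by (intro Axm G6) auto
  then show ?thesis using assms MP by blast
qed

text \<open>Disjunction is a defined conjunction: under \<open>a\<close> implies \<open>b\<close>
  its first conjunct yields \<open>b\<close>, in the converse case its second yields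
  \<open>a\<close>.\<close>

lemma orE:
  assumes "D (a \<^bold>\<or> b)" "D (a \<^bold>\<longrightarrow> c)" "D (b \<^bold>\<longrightarrow> c)"
  shows "D c"
  using assms conjD1 conjD2 syl linear_cases by meson

lemma GA2_rule:
  "D (All x (\<psi> \<^bold>\<longrightarrow> \<phi>)) \<Longrightarrow> x \<notin> fv \<psi> \<Longrightarrow> D (\<psi> \<^bold>\<longrightarrow> All x \<phi>)"
  by (rule MP, assumption, rule Axm, rule GA2) (auto dest: D_wf)

lemma GA3_rule:
  "D (All x (\<psi> \<^bold>\<or> \<phi>)) \<Longrightarrow> x \<notin> fv \<psi> \<Longrightarrow> D (\<psi> \<^bold>\<or> All x \<phi>)"
  by (rule MP, assumption, rule Axm, rule GA3) (auto dest: D_wf)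

text \<open>Contraction lets one copy of \<psi> serve both premises of modus ponens, and closedness
  of \<psi> lets generalization pass by \<open>GA2\<close>.\<close>

lemma deduction:
  assumes "deriv A L (insert \<psi> T) \<phi>" "sentence A L \<psi>"
  shows "D (\<psi> \<^bold>\<longrightarrow> \<phi>)"
proof -
  have W: "W \<psi>" and fv: "fv \<psi> = {}" using assms(2) by (auto simp: sentence_def)
  show ?thesis
    using assms(1)
  proof induction
    case (Hyp \<phi>)
    then show ?case using refl[OF W] weaken[OF W] deriv.Hyp by blast
  next
    case (Axm \<phi>)
    then show ?case using weaken[OF W] deriv.Axm by blast
  next
    case (MP \<phi> \<chi>)
    then show ?case using mp_under by blast
  next
    case (Gen \<phi> x)
    then show ?case using fv by (intro GA2_rule deriv.Gen) auto
  qed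
qed

end

section \<open>Replacing names by a fresh variable\<close>

text \<open>The filter \<open>sequentially\<close> on variable indices expresses "for all but
  finitely many variables", so freshness conditions combine without explicit bounds.\<close>

lemma eventually_not_in_finite: "finite S \<Longrightarrow> \<forall>\<^sub>F y in sequentially. (y::nat) \<notin> S"
  by (simp add: eventually_cofinite flip: cofinite_eq_sequentially)

lemma eventually_neq_nat: "\<forall>\<^sub>F y in sequentially. (y::nat) \<noteq> x"
  using eventually_not_in_finite[of "{x}"] by simp

lemma finite_fv_tm: "finite (fv_tm t)"
  by (induction t) auto

lemma finite_fv: "finite (fv \<phi>)"
  by (induction \<phi>) (auto simp: finite_fv_tm)

lemma subst_tm_fresh: "y \<notin> fv_tm t \<Longrightarrow> subst_tm t y u = t"
  by (induction t) (auto intro: map_idI)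

lemma subst_fresh: "y \<notin> fv \<phi> \<Longrightarrow> subst \<phi> y u = \<phi>"
  by (induction \<phi>) (auto intro: map_idI simp: subst_tm_fresh)

lemma substitutable_fresh: "y \<notin> fv \<phi> \<Longrightarrow> substitutable u y \<phi>"
  by (induction \<phi>) auto

lemma subst_tm_back: "y \<notin> fv_tm t \<Longrightarrow> subst_tm (subst_tm t x (Var y)) y (Var x) = t"
  by (induction t) (auto intro: map_idI)

text \<open>Any \<open>y\<close> occurring neither free nor bound in \<phi> works: the places it
  fills were free occurrences of \<open>x\<close>, hence lie under no quantifier over
  \<open>x\<close>.\<close>

lemma eventually_subst_back:
  "\<forall>\<^sub>F y in sequentially. subst (subst \<phi> x (Var y)) y (Var x) = \<phi> \<and>
     substitutable (Var x) y (subst \<phi> x (Var y))"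
proof (induction \<phi>)
  case (Rel p ts)
  show ?case
    using eventually_not_in_finite[OF finite_fv, of "Rel p ts"]
    by eventually_elim (auto intro!: map_idI simp: subst_tm_back)
next
  case (And \<phi> \<psi>)
  then show ?case by eventually_elim auto
next
  case (Imp \<phi> \<psi>)
  then show ?case by eventually_elim auto
next
  case (All z \<phi>)
  show ?case
    using All eventually_neq_nat[of z] eventually_not_in_finite[OF finite_fv, of \<phi>]
    by eventually_elim (auto simp: subst_fresh substitutable_fresh)
next
  case (Ex z \<phi>)
  show ?case
    using Ex eventually_neq_nat[of z] eventually_not_in_finite[OF finite_fv, of \<phi>]
    by eventually_elim (auto simp: subst_fresh substitutable_fresh)
qed auto

text \<open>Partial renaming: a term whose head has no image collapses to the variable
  \<open>y\<close>. One notion thus covers both erasing a single Henkin constant and undoing the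
  whole language extension.\<close>

primrec rn_tm :: "('g \<Rightarrow> 'f option) \<Rightarrow> nat \<Rightarrow> 'g tm \<Rightarrow> 'f tm" where
  "rn_tm g y (Var x) = Var x"
| "rn_tm g y (Fn f ts) = (case g f of None \<Rightarrow> Var y | Some h \<Rightarrow> Fn h (map (rn_tm g y) ts))"

primrec rn_fm :: "('g \<Rightarrow> 'f option) \<Rightarrow> nat \<Rightarrow> ('g, 'p) fm \<Rightarrow> ('f, 'p) fm" where
  "rn_fm g y Bot = Bot"
| "rn_fm g y (Const r) = Const r"
| "rn_fm g y (Rel p ts) = Rel p (map (rn_tm g y) ts)"
| "rn_fm g y (\<phi> \<^bold>\<and> \<psi>) = rn_fm g y \<phi> \<^bold>\<and> rn_fm g y \<psi>"
| "rn_fm g y (\<phi> \<^bold>\<longrightarrow> \<psi>) = rn_fm g y \<phi> \<^bold>\<longrightarrow> rn_fm g y \<psi>"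
| "rn_fm g y (All x \<phi>) = All x (rn_fm g y \<phi>)"
| "rn_fm g y (Ex x \<phi>) = Ex x (rn_fm g y \<phi>)"

lemma rn_tconst [simp]: "rn_fm g y (tconst r) = tconst r"
  by (auto simp: tconst_def)

section \<open>Partial renaming preserves derivations\<close>

lemma fv_rn_tm: "fv_tm (rn_tm g y t) \<subseteq> insert y (fv_tm t)"
  by (induction t) (auto split: option.split)

lemma fv_rn_fm: "fv (rn_fm g y \<phi>) \<subseteq> insert y (fv \<phi>)"
proof (induction \<phi>)
  case (Rel p ts)
  then show ?case using fv_rn_tm by fastforce
qed auto

lemma rn_subst_tm:
  "y \<noteq> x \<Longrightarrow> rn_tm g y (subst_tm u x t) = subst_tm (rn_tm g y u) x (rn_tm g y t)"
  by (induction u) (auto split: option.split)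

lemma rn_subst:
  "y \<noteq> x \<Longrightarrow> rn_fm g y (subst \<phi> x t) = subst (rn_fm g y \<phi>) x (rn_tm g y t)"
  by (induction \<phi>) (auto simp: rn_subst_tm)

lemma rn_wf_tm:
  assumes "\<And>f n h. (f, n) \<in> Funs L \<Longrightarrow> g f = Some h \<Longrightarrow> (h, n) \<in> Funs M"
  shows "wf_tm L t \<Longrightarrow> wf_tm M (rn_tm g y t)"
  by (induction t) (auto split: option.split simp: list_all_iff assms)

lemma rn_wf_fm:
  assumes "\<And>f n h. (f, n) \<in> Funs L \<Longrightarrow> g f = Some h \<Longrightarrow> (h, n) \<in> Funs M"
    and "Preds L \<subseteq> Preds M"
  shows "wf_fm A L \<phi> \<Longrightarrow> wf_fm A M (rn_fm g y \<phi>)"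
proof (induction \<phi>)
  case (Rel p ts)
  then show ?case using assms(2) rn_wf_tm[of L g M, OF assms(1)] by (auto simp: list_all_iff)
qed auto

text \<open>Renaming adds at most \<open>y\<close> to the free variables, so it suffices that
  \<open>y\<close> avoids \<open>x\<close> and the finitely many bound variables of \<phi>.\<close>

lemma eventually_rn_substitutable:
  "substitutable t x \<phi> \<Longrightarrow>
     \<forall>\<^sub>F y in sequentially. substitutable (rn_tm g y t) x (rn_fm g y \<phi>)"
proof (induction \<phi>)
  case (And \<phi> \<psi>)
  then have "\<forall>\<^sub>F y in sequentially. substitutable (rn_tm g y t) x (rn_fm g y \<phi>)"
    "\<forall>\<^sub>F y in sequentially. substitutable (rn_tm g y t) x (rn_fm g y \<psi>)" by auto
  then show ?case by eventually_elim auto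
next
  case (Imp \<phi> \<psi>)
  then have "\<forall>\<^sub>F y in sequentially. substitutable (rn_tm g y t) x (rn_fm g y \<phi>)"
    "\<forall>\<^sub>F y in sequentially. substitutable (rn_tm g y t) x (rn_fm g y \<psi>)" by auto
  then show ?case by eventually_elim auto
next
  case (All z \<phi>)
  show ?case
  proof (cases "x \<in> fv \<phi> - {z}")
    case True
    with All have "\<forall>\<^sub>F y in sequentially. substitutable (rn_tm g y t) x (rn_fm g y \<phi>)" by auto
    with eventually_neq_nat[of z] show ?thesis
      by eventually_elim (use All.prems True fv_rn_tm in fastforce)
  next
    case False
    show ?thesis
      using eventually_neq_nat[of x] by eventually_elim (use False fv_rn_fm in fastforce)
  qed
next
  case (Ex z \<phi>)
  show ?case
  proof (cases "x \<in> fv \<phi> - {z}")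
    case True
    with Ex have "\<forall>\<^sub>F y in sequentially. substitutable (rn_tm g y t) x (rn_fm g y \<phi>)" by auto
    with eventually_neq_nat[of z] show ?thesis
      by eventually_elim (use Ex.prems True fv_rn_tm in fastforce)
  next
    case False
    show ?thesis
      using eventually_neq_nat[of x] by eventually_elim (use False fv_rn_fm in fastforce)
  qed
qed auto

text \<open>Axioms are schemes, so only side conditions matter; they survive when \<open>y\<close>
  differs from the quantified variable and is not captured on substitution.\<close>

lemma eventually_rn_axiom:
  assumes "axiom A \<phi>"
  shows "\<forall>\<^sub>F y in sequentially. axiom A (rn_fm g y \<phi>)"
  using assms
proof cases
  case (GA1 t x \<psi>)
  show ?thesis
    using eventually_rn_substitutable[OF GA1(2)] eventually_neq_nat[of x]
    by eventually_elim (auto simp: GA1(1) rn_subst intro: axiom.GA1)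
next
  case (GE1 t x \<psi>)
  show ?thesis
    using eventually_rn_substitutable[OF GE1(2)] eventually_neq_nat[of x]
    by eventually_elim (auto simp: GE1(1) rn_subst intro: axiom.GE1)
next
  case (GA2 x \<psi> \<theta>)
  show ?thesis
    using eventually_neq_nat[of x]
    by eventually_elim (use GA2 fv_rn_fm in \<open>fastforce intro: axiom.GA2\<close>)
next
  case (GA3 x \<psi> \<theta>)
  show ?thesis
    using eventually_neq_nat[of x]
    by eventually_elim (use GA3 fv_rn_fm in \<open>fastforce intro: axiom.GA3\<close>)
next
  case (GE2 x \<psi> \<theta>)
  show ?thesis
    using eventually_neq_nat[of x]
    by eventually_elim (use GE2 fv_rn_fm in \<open>fastforce intro: axiom.GE2\<close>)
qed (auto intro!: always_eventually intro: axiom.intros)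

text \<open>Each axiom in a derivation excludes only finitely many \<open>y\<close>, and a
  derivation is finite.\<close>

lemma eventually_rn_deriv:
  assumes "deriv A L T \<phi>"
    and "\<And>f n h. (f, n) \<in> Funs L \<Longrightarrow> g f = Some h \<Longrightarrow> (h, n) \<in> Funs M"
    and "Preds L \<subseteq> Preds M"
    and "\<And>\<phi> y. \<phi> \<in> T \<Longrightarrow> rn_fm g y \<phi> \<in> S"
  shows "\<forall>\<^sub>F y in sequentially. deriv A M S (rn_fm g y \<phi>)"
  using assms(1)
proof induction
  case (Hyp \<phi>)
  then show ?case by (intro always_eventually allI deriv.Hyp assms(4))
next
  case (Axm \<phi>)
  show ?case
    using eventually_rn_axiom[OF Axm(1)]
    by eventually_elim (use rn_wf_fm[OF assms(2,3) Axm(2)] in \<open>auto intro: deriv.Axm\<close>)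
next
  case (MP \<phi> \<psi>)
  from MP.IH show ?case by eventually_elim (auto intro: deriv.MP)
next
  case (Gen \<phi> x)
  from Gen.IH show ?case by eventually_elim (auto intro: deriv.Gen)
qed

definition omit :: "'f \<Rightarrow> 'f \<Rightarrow> 'f option" where
  "omit c f = (if f = c then None else Some f)"

lemma rn_omit_tm: "c \<notin> set_tm t \<Longrightarrow> rn_tm (omit c) y t = t"
  by (induction t) (auto simp: omit_def intro: map_idI)

lemma rn_omit_fm: "c \<notin> set1_fm \<phi> \<Longrightarrow> rn_fm (omit c) y \<phi> = \<phi>"
  by (induction \<phi>) (auto simp: rn_omit_tm intro: map_idI)

section \<open>Henkin axioms\<close>

text \<open>With 0 as truth, \<open>All\<close> is a supremum of truth degrees. If it is at least
  \<open>r\<close>, some instance is at least any given \<open>s < r\<close>, although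
  \<open>r\<close> itself need not be attained.\<close>

definition henkin_ax :: "nat \<Rightarrow> ('f, 'p) fm \<Rightarrow> real \<Rightarrow> real \<Rightarrow> 'f \<Rightarrow> ('f, 'p) fm" where
  "henkin_ax x \<phi> r s c =
     ((All x \<phi> \<^bold>\<longrightarrow> tconst r) \<^bold>\<longrightarrow> (subst \<phi> x (Fn c []) \<^bold>\<longrightarrow> tconst s))"

text \<open>The variable \<open>y\<close> stands for the Henkin constant; the conditions on
  \<open>y\<close> allow it to be renamed back to \<open>x\<close>.\<close>

lemma (in theory_context) henkin_conservative_var:
  assumes r: "r \<in> A" and s: "s \<in> A" and "s < r" and fresh: "x \<notin> fv \<theta>"
    and y: "subst (subst \<phi> x (Var y)) y (Var x) = \<phi>" "substitutable (Var x) y (subst \<phi> x (Var y))"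
    and \<theta>: "subst \<theta> y (Var x) = \<theta>" "substitutable (Var x) y \<theta>"
    and d: "D (((All x \<phi> \<^bold>\<longrightarrow> tconst r) \<^bold>\<longrightarrow> (subst \<phi> x (Var y) \<^bold>\<longrightarrow> tconst s)) \<^bold>\<longrightarrow> \<theta>)"
  shows "D \<theta>"
proof -
  let ?q = "subst \<phi> x (Var y)" and ?p = "All x \<phi> \<^bold>\<longrightarrow> tconst r" and ?s = "tconst s :: ('f, 'p) fm"
  let ?r = "tconst r :: ('f, 'p) fm"
  have W: "W ?q" "W \<phi>" "W ?s" "W ?r" "W \<theta>" using D_wf[OF d] by auto
  \<comment> \<open>If \<open>?q\<close> implies \<open>?s\<close>, the Henkin axiom holds by
    weakening and gives \<theta>; the converse comparison is the other disjunct.\<close>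
  have "D ((?q \<^bold>\<longrightarrow> ?s) \<^bold>\<longrightarrow> (?p \<^bold>\<longrightarrow> (?q \<^bold>\<longrightarrow> ?s)))" using W by (intro K) auto
  then have "D ((?q \<^bold>\<longrightarrow> ?s) \<^bold>\<longrightarrow> (\<theta> \<^bold>\<or> (?s \<^bold>\<longrightarrow> ?q)))"
    by (rule syl[OF syl[OF _ d] orI1]) (use W in auto)
  moreover have "D ((?s \<^bold>\<longrightarrow> ?q) \<^bold>\<longrightarrow> (\<theta> \<^bold>\<or> (?s \<^bold>\<longrightarrow> ?q)))" using W by (intro orI2) auto
  ultimately have "D (\<theta> \<^bold>\<or> (?s \<^bold>\<longrightarrow> ?q))" by (rule linear_cases)
  then have 1: "D (All y (\<theta> \<^bold>\<or> (?s \<^bold>\<longrightarrow> ?q)))" by (rule Gen)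
  \<comment> \<open>Instantiating \<open>y\<close> by \<open>x\<close> recovers \<phi>, so that the
    quantifier shift below concerns the original \<open>All x \<phi>\<close>.\<close>
  have "D (All y (\<theta> \<^bold>\<or> (?s \<^bold>\<longrightarrow> ?q)) \<^bold>\<longrightarrow> subst (\<theta> \<^bold>\<or> (?s \<^bold>\<longrightarrow> ?q)) y (Var x))"
    using W y \<theta> by (intro Axm GA1) auto
  from MP[OF 1 this] have "D (\<theta> \<^bold>\<or> (?s \<^bold>\<longrightarrow> \<phi>))" using y \<theta> by simp
  then have "D (\<theta> \<^bold>\<or> All x (?s \<^bold>\<longrightarrow> \<phi>))" using fresh by (intro GA3_rule Gen)
  moreover have "D (\<theta> \<^bold>\<longrightarrow> \<theta>)" using W by (intro refl)
  moreover have "D (All x (?s \<^bold>\<longrightarrow> \<phi>) \<^bold>\<longrightarrow> \<theta>)"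
  proof (rule syl[OF _ syl[OF _ d]])
    show "D (All x (?s \<^bold>\<longrightarrow> \<phi>) \<^bold>\<longrightarrow> (?s \<^bold>\<longrightarrow> All x \<phi>))"
      using W by (intro Axm GA2) auto
    \<comment> \<open>Here \<open>s < r\<close> enters: by \<open>RG2b\<close> the implication from
      \<open>?s\<close> to \<open>?r\<close> collapses to \<open>?r\<close>, which implies
      \<open>?s\<close> by \<open>RG2a\<close>.\<close>
    have "D ((?s \<^bold>\<longrightarrow> ?r) \<^bold>\<longrightarrow> ?r)"
      by (rule conjD1, rule Axm, rule RG2b) (use r s \<open>s < r\<close> W in auto)
    moreover have "D (?r \<^bold>\<longrightarrow> ?s)"
      by (rule Axm, rule RG2a) (use r s \<open>s < r\<close> W in auto)
    moreover have "D (?s \<^bold>\<longrightarrow> (?q \<^bold>\<longrightarrow> ?s))" using W by (intro K)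
    ultimately have "D ((?s \<^bold>\<longrightarrow> ?r) \<^bold>\<longrightarrow> (?q \<^bold>\<longrightarrow> ?s))" using syl by blast
    moreover have "D (((?s \<^bold>\<longrightarrow> All x \<phi>) \<^bold>\<and> ?p) \<^bold>\<longrightarrow> (?s \<^bold>\<longrightarrow> ?r))"
      by (rule uncurry, rule Axm, rule G1) (use W in auto)
    ultimately show "D ((?s \<^bold>\<longrightarrow> All x \<phi>) \<^bold>\<longrightarrow> (?p \<^bold>\<longrightarrow> (?q \<^bold>\<longrightarrow> ?s)))"
      by (blast intro: curry syl)
  qed
  ultimately show ?thesis by (rule orE)
qed

section \<open>Henkin axioms with a fresh constant\<close>

lemma fv_tm_subst_closed: "fv_tm u = {} \<Longrightarrow> fv_tm (subst_tm t x u) = fv_tm t - {x}"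
  by (induction t) auto

lemma fv_subst_closed: "fv_tm u = {} \<Longrightarrow> fv (subst \<phi> x u) = fv \<phi> - {x}"
  by (induction \<phi>) (auto simp: fv_tm_subst_closed)

lemma wf_subst_tm: "wf_tm L u \<Longrightarrow> wf_tm L t \<Longrightarrow> wf_tm L (subst_tm t x u)"
  by (induction t) (auto simp: list_all_iff)

lemma wf_subst: "wf_tm L u \<Longrightarrow> wf_fm A L \<phi> \<Longrightarrow> wf_fm A L (subst \<phi> x u)"
  by (induction \<phi>) (auto simp: list_all_iff wf_subst_tm)

lemma sentence_henkin_ax:
  assumes "r \<in> A" "s \<in> A" "sentence A L (All x \<phi>)" "(c, 0) \<in> Funs L"
  shows "sentence A L (henkin_ax x \<phi> r s c)"
  using assms by (auto simp: sentence_def henkin_ax_def fv_subst_closed intro!: wf_subst)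

text \<open>The deduction theorem makes the Henkin axiom a premise; erasing \<open>c\<close> then
  changes only its occurrence as a witness, because \<phi> and the theory do not contain it.\<close>

lemma (in theory_context) henkin_conservative:
  assumes r: "r \<in> A" and s: "s \<in> A" and "s < r"
    and \<phi>: "sentence A L (All x \<phi>)" and c: "(c, 0) \<in> Funs L"
    and fresh: "c \<notin> set1_fm \<phi>" "\<And>\<psi>. \<psi> \<in> T \<Longrightarrow> c \<notin> set1_fm \<psi>"
    and d: "deriv A L (insert (henkin_ax x \<phi> r s c) T) (tconst t)"
  shows "D (tconst t)"
proof -
  have "D (henkin_ax x \<phi> r s c \<^bold>\<longrightarrow> tconst t)"
    using d sentence_henkin_ax[OF r s \<phi> c] by (rule deduction)
  then have "\<forall>\<^sub>F y in sequentially. D (rn_fm (omit c) y (henkin_ax x \<phi> r s c \<^bold>\<longrightarrow> tconst t))"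
    by (rule eventually_rn_deriv) (auto simp: omit_def rn_omit_fm fresh split: if_splits)
  then have "\<forall>\<^sub>F y in sequentially. D (tconst t)"
    using eventually_subst_back[of \<phi> x] eventually_neq_nat[of x]
  proof eventually_elim
    case (elim y)
    then show ?case
      using fresh
      by (intro henkin_conservative_var[OF r s \<open>s < r\<close>, of x "tconst t" \<phi> y])
         (auto simp: henkin_ax_def rn_subst rn_omit_fm omit_def)
  qed
  \<comment> \<open>The claim no longer mentions \<open>y\<close>, and \<open>sequentially\<close>
    is not the trivial filter.\<close>
  then show ?thesis by simp
qed

section \<open>Naming the Henkin constants\<close>

text \<open>Formulas over the extended names are coded by formulas over the old names so that a new
  name occurring in a formula is smaller than the code of that formula. A Henkin constant named
  by a code is therefore fresh for all Henkin axioms whose codes are not larger.\<close>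

primrec enc_tm :: "('f, 'p) ext_names tm \<Rightarrow> ('f, 'p) fm" where
  "enc_tm (Var x) = All x Bot"
| "enc_tm (Fn f ts) =
     (case f of Inl h \<Rightarrow> Rel undefined [Fn h []] | Inr \<psi> \<Rightarrow> Ex 0 \<psi>) \<^bold>\<and> foldr And (map enc_tm ts) Bot"

primrec enc :: "(('f, 'p) ext_names, 'p) fm \<Rightarrow> ('f, 'p) fm" where
  "enc Bot = Bot"
| "enc (Const r) = Const r"
| "enc (Rel p ts) = Rel p [] \<^bold>\<longrightarrow> foldr And (map enc_tm ts) Bot"
| "enc (\<phi> \<^bold>\<and> \<psi>) = enc \<phi> \<^bold>\<and> enc \<psi>"
| "enc (\<phi> \<^bold>\<longrightarrow> \<psi>) = enc \<phi> \<^bold>\<longrightarrow> enc \<psi>"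
| "enc (All x \<phi>) = All x (enc \<phi>)"
| "enc (Ex x \<phi>) = Ex x (enc \<phi>)"

text \<open>\<open>Bot\<close> ends the list and \<open>And\<close> extends it, so the length can be
  read off. Injectivity of \<open>e\<close> is asked only at members of \<open>ts\<close>, which is
  what an induction hypothesis on terms supplies.\<close>

lemma foldr_And_inj:
  assumes "\<And>t u. t \<in> set ts \<Longrightarrow> e t = e u \<Longrightarrow> t = u"
    and "foldr And (map e ts) Bot = foldr And (map e us) Bot"
  shows "ts = us"
  using assms
proof (induction ts arbitrary: us)
  case Nil
  then show ?case by (cases us) auto
next
  case (Cons t ts)
  from Cons.prems(2) obtain u us' where us: "us = u # us'" by (cases us) auto
  have "t = u" using Cons.prems(1)[of t u] Cons.prems(2) us by auto
  moreover have "ts = us'"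
    using Cons.prems us by (intro Cons.IH) auto
  ultimately show ?case using us by simp
qed

text \<open>The connectives act as tags: \<open>All\<close> for variables, \<open>And\<close> for
  applications, and there \<open>Rel\<close> for old and \<open>Ex\<close> for new names. The
  predicate name \<open>undefined\<close> is an arbitrary fixed filler.\<close>

lemma enc_tm_inj: "enc_tm t = enc_tm u \<Longrightarrow> t = u"
proof (induction t arbitrary: u)
  case (Var x)
  then show ?case by (cases u) auto
next
  case (Fn f ts)
  then obtain g us where u: "u = Fn g us" by (cases u) auto
  have "f = g" using Fn.prems by (auto simp: u split: sum.splits)
  moreover have "ts = us"
    using Fn.prems by (intro foldr_And_inj[of ts enc_tm us] Fn.IH) (auto simp: u)
  ultimately show ?case using u by simp
qed

text \<open>An atom is coded as an implication from a bare \<open>Rel\<close>; since no code is a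
  \<open>Rel\<close>, it cannot be mistaken for the code of an implication.\<close>

lemma enc_neq_Rel [simp]: "enc \<phi> \<noteq> Rel p ts" "Rel p ts \<noteq> enc \<phi>"
  by (cases \<phi>; simp)+

lemma enc_inj: "enc \<phi> = enc \<psi> \<Longrightarrow> \<phi> = \<psi>"
proof (induction \<phi> arbitrary: \<psi>)
  case (Rel p ts)
  then obtain q us where "\<psi> = Rel q us" by (cases \<psi>) auto
  with Rel show ?case using foldr_And_inj[of ts enc_tm us] enc_tm_inj by auto
next
  case Bot
  then show ?case by (cases \<psi>) auto
next
  case (Const r)
  then show ?case by (cases \<psi>) auto
next
  case (And \<phi>1 \<phi>2)
  then show ?case by (cases \<psi>) auto
next
  case (Imp \<phi>1 \<phi>2)
  then show ?case by (cases \<psi>) auto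
next
  case (All x \<phi>)
  then show ?case by (cases \<psi>) auto
next
  case (Ex x \<phi>)
  then show ?case by (cases \<psi>) auto
qed

section \<open>New names are smaller than codes\<close>

lemma size_foldr_And: "\<phi> \<in> set \<phi>s \<Longrightarrow> size \<phi> < size (foldr And \<phi>s Bot)"
  by (induction \<phi>s) auto

lemma size_enc_tm: "Inr \<psi> \<in> set_tm t \<Longrightarrow> size \<psi> < size (enc_tm t)"
proof (induction t)
  case (Fn f ts)
  show ?case
  proof (cases "f = Inr \<psi>")
    case False
    with Fn.prems obtain t where "t \<in> set ts" "Inr \<psi> \<in> set_tm t" by auto
    with Fn.IH size_foldr_And[of "enc_tm t" "map enc_tm ts"] show ?thesis by fastforce
  qed auto
qed auto

lemma size_enc: "Inr \<psi> \<in> set1_fm \<phi> \<Longrightarrow> size \<psi> < size (enc \<phi>)"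
proof (induction \<phi>)
  case (Rel p ts)
  then obtain t where "t \<in> set ts" "Inr \<psi> \<in> set_tm t" by auto
  with size_enc_tm size_foldr_And[of "enc_tm t" "map enc_tm ts"] show ?case by fastforce
qed auto

text \<open>All four components are kept, so distinct Henkin axioms get distinct constants, and the
  code of \<phi> is a proper part, so the constant does not occur in \<phi>.\<close>

definition henkin_code ::
    "nat \<times> (('f, 'p) ext_names, 'p) fm \<times> real \<times> real \<Rightarrow> ('f, 'p) fm" where
  "henkin_code = (\<lambda>(x, \<phi>, r, s). enc (Const r \<^bold>\<and> Const s \<^bold>\<and> All x \<phi>))"

definition henkin_of ::
    "nat \<times> (('f, 'p) ext_names, 'p) fm \<times> real \<times> real \<Rightarrow> (('f, 'p) ext_names, 'p) fm" where
  "henkin_of i = (case i of (x, \<phi>, r, s) \<Rightarrow> henkin_ax x \<phi> r s (Inr (henkin_code i)))"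

lemma henkin_code_inj: "henkin_code i = henkin_code j \<Longrightarrow> i = j"
  by (auto simp: henkin_code_def dest: enc_inj split: prod.splits)

lemma set_subst_tm: "set_tm (subst_tm t x u) \<subseteq> set_tm t \<union> set_tm u"
  by (induction t) auto

lemma set1_subst: "set1_fm (subst \<phi> x u) \<subseteq> set1_fm \<phi> \<union> set_tm u"
proof (induction \<phi>)
  case (Rel p ts)
  then show ?case using set_subst_tm by fastforce
qed auto

lemma set1_tconst [simp]: "set1_fm (tconst r) = {}"
  by (auto simp: tconst_def)

text \<open>A new name in the axiom of \<open>j\<close> is either its own constant, excluded by
  injectivity, or occurs in its formula and is then smaller than the code of
  \<open>j\<close>.\<close>

lemma henkin_code_fresh:
  assumes "size (henkin_code j) \<le> size (henkin_code i)" and "i \<noteq> j"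
  shows "Inr (henkin_code i) \<notin> set1_fm (henkin_of j)"
proof
  obtain x \<phi> r s where j: "j = (x, \<phi>, r, s)" by (cases j)
  assume "Inr (henkin_code i) \<in> set1_fm (henkin_of j)"
  then have "Inr (henkin_code i) \<in> set1_fm \<phi> \<or> henkin_code i = henkin_code j"
    using set1_subst[of \<phi> x "Fn (Inr (henkin_code j)) []"]
    by (auto simp: henkin_of_def henkin_ax_def j)
  then have "size (henkin_code i) < size (enc \<phi>)"
    using size_enc henkin_code_inj assms(2) by blast
  also have "\<dots> < size (henkin_code j)" by (simp add: henkin_code_def j)
  finally show False using assms(1) by simp
qed

lemma henkin_code_fresh_self:
  "Inr (henkin_code (x, \<phi>, r, s)) \<notin> set1_fm \<phi>"
proof
  assume "Inr (henkin_code (x, \<phi>, r, s)) \<in> set1_fm \<phi>"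
  then have "size (henkin_code (x, \<phi>, r, s)) < size (enc \<phi>)" by (rule size_enc)
  then show False by (simp add: henkin_code_def)
qed

section \<open>The extended language\<close>

text \<open>Every formula becomes a constant at once, whether or not it is a code. The language thus
  needs no construction in stages; the ordering by size replaces the stages.\<close>

definition henkin_lang :: "('f, 'p) lang \<Rightarrow> (('f, 'p) ext_names, 'p) lang" where
  "henkin_lang L = \<lparr>Funs = Funs (embed_lang L) \<union> range (\<lambda>\<psi>. (Inr \<psi>, 0)), Preds = Preds L\<rparr>"

definition henkin_index ::
    "real set \<Rightarrow> ('f, 'p) lang \<Rightarrow> (nat \<times> (('f, 'p) ext_names, 'p) fm \<times> real \<times> real) set" where
  "henkin_index A L =
     {(x, \<phi>, r, s). sentence A (henkin_lang L) (All x \<phi>) \<and> r \<in> A \<and> s \<in> A \<and> s < r}"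

lemma Inr_in_henkin_lang [simp]: "(Inr \<psi>, 0) \<in> Funs (henkin_lang L)"
  by (simp add: henkin_lang_def)

lemma sentence_henkin_of: "i \<in> henkin_index A L \<Longrightarrow> sentence A (henkin_lang L) (henkin_of i)"
  by (auto simp: henkin_index_def henkin_of_def intro: sentence_henkin_ax)

section \<open>Embedding old formulas and undoing it\<close>

lemma fv_tm_map: "fv_tm (map_tm f t) = fv_tm t"
  by (induction t) auto

lemma fv_embed: "fv (embed_fm \<phi>) = fv \<phi>"
  unfolding embed_fm_def by (induction \<phi>) (auto simp: fv_tm_map)

lemma wf_embed_tm: "wf_tm L t \<Longrightarrow> wf_tm (henkin_lang L) (map_tm Inl t)"
  by (induction t) (auto simp: list_all_iff henkin_lang_def embed_lang_def)

lemma wf_embed: "wf_fm A L \<phi> \<Longrightarrow> wf_fm A (henkin_lang L) (embed_fm \<phi>)"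
  unfolding embed_fm_def
proof (induction \<phi>)
  case (Rel p ts)
  then show ?case by (auto simp: list_all_iff wf_embed_tm) (simp add: henkin_lang_def)
qed auto

lemma theory_embed: "theory_in A L T \<Longrightarrow> theory_in A (henkin_lang L) (embed_fm ` T)"
  by (auto simp: theory_in_def sentence_def fv_embed wf_embed)

lemma Inr_notin_embed: "Inr \<psi> \<notin> set1_fm (embed_fm \<phi>)"
  by (auto simp: embed_fm_def fm.set_map)

definition unembed :: "'f + 'g \<Rightarrow> 'f option" where
  "unembed = case_sum Some (\<lambda>_. None)"

lemma unembed_simps [simp]:
  "unembed (Inl h) = Some h" "unembed (Inr \<psi>) = None" "unembed f = Some h \<longleftrightarrow> f = Inl h"
  by (auto simp: unembed_def split: sum.splits)

lemma rn_unembed_tm: "rn_tm unembed y (map_tm Inl t) = t"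
  by (induction t) (auto intro: map_idI)

lemma rn_unembed: "rn_fm unembed y (embed_fm \<phi>) = \<phi>"
  unfolding embed_fm_def by (induction \<phi>) (auto simp: rn_unembed_tm intro: map_idI)

text \<open>A derivation in the larger language is pulled back by sending all new constants to one
  fresh variable; truth constants are unchanged.\<close>

lemma strongly_consistent_embed:
  assumes "strongly_consistent A L T"
  shows "strongly_consistent A (henkin_lang L) (embed_fm ` T)"
  unfolding strongly_consistent_def
proof (intro ballI notI)
  fix r assume r: "r \<in> A \<union> {1}"
    and "deriv A (henkin_lang L) (embed_fm ` T) (tconst r)"
  then have "\<forall>\<^sub>F y in sequentially. deriv A L T (rn_fm unembed y (tconst r :: (('a, 'b) ext_names, 'b) fm))"
    by (intro eventually_rn_deriv)
       (auto simp: rn_unembed henkin_lang_def embed_lang_def)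
  then show False using assms r by (auto simp: strongly_consistent_def)
qed

text \<open>Adding the axioms in order of nondecreasing code size keeps each new constant fresh for
  the axioms already present.\<close>

lemma strongly_consistent_henkin_finite:
  assumes "theory_in A L T" "strongly_consistent A L T" "finite F" "F \<subseteq> henkin_index A L"
  shows "strongly_consistent A (henkin_lang L) (embed_fm ` T \<union> henkin_of ` F)"
  using assms(3,4)
proof (induction F rule: finite_ranking_induct[where f = "\<lambda>i. size (henkin_code i)"])
  case empty
  then show ?case using strongly_consistent_embed[OF assms(2)] by simp
next
  case (insert i F)
  show ?case
  \<comment> \<open>The ranking induction allows \<open>i\<close> to be in \<open>F\<close>, whereas
    freshness needs it to differ from the earlier indices.\<close>
  proof (cases "i \<in> F")
    case True
    then show ?thesis using insert by (simp add: Set.insert_absorb)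
  next
    case False
    let ?S = "embed_fm ` T \<union> henkin_of ` F"
    obtain x \<phi> r s where i: "i = (x, \<phi>, r, s)" by (cases i)
    interpret theory_context A "henkin_lang L" ?S
    proof
      have "sentence A (henkin_lang L) (henkin_of j)" if "j \<in> F" for j
        using that insert.prems sentence_henkin_of[of j A L] by blast
      then show "theory_in A (henkin_lang L) ?S"
        using theory_embed[OF assms(1)] by (auto simp: theory_in_def)
    qed
    have "deriv A (henkin_lang L) ?S (tconst t)"
      if "deriv A (henkin_lang L) (insert (henkin_of i) ?S) (tconst t)" for t
    proof (rule henkin_conservative)
      show "r \<in> A" "s \<in> A" "s < r" "sentence A (henkin_lang L) (All x \<phi>)"
        using insert by (auto simp: i henkin_index_def)
      show "(Inr (henkin_code i), 0) \<in> Funs (henkin_lang L)" by simp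
      show "Inr (henkin_code i) \<notin> set1_fm \<phi>" unfolding i by (rule henkin_code_fresh_self)
      show "Inr (henkin_code i) \<notin> set1_fm \<psi>" if "\<psi> \<in> ?S" for \<psi>
        using that insert False Inr_notin_embed henkin_code_fresh by blast
      show "deriv A (henkin_lang L)
          (insert (henkin_ax x \<phi> r s (Inr (henkin_code i))) ?S) (tconst t)"
        using that by (simp add: henkin_of_def i)
    qed
    then show ?thesis using insert by (auto simp: strongly_consistent_def)
  qed
qed

lemma strongly_consistent_henkin:
  assumes "theory_in A L T" "strongly_consistent A L T"
  shows "strongly_consistent A (henkin_lang L) (embed_fm ` T \<union> henkin_of ` henkin_index A L)"
  unfolding strongly_consistent_def
proof (intro ballI notI)
  fix r assume r: "r \<in> A \<union> {1}"
    and d: "deriv A (henkin_lang L) (embed_fm ` T \<union> henkin_of ` henkin_index A L) (tconst r)"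
  obtain G where G: "finite G" "G \<subseteq> embed_fm ` T \<union> henkin_of ` henkin_index A L"
    "deriv A (henkin_lang L) G (tconst r)" using deriv_finite[OF d] by blast
  have "finite (G - embed_fm ` T)" "G - embed_fm ` T \<subseteq> henkin_of ` henkin_index A L"
    using G by auto
  then obtain F where F: "F \<subseteq> henkin_index A L" "finite F" "G - embed_fm ` T = henkin_of ` F"
    by (meson finite_subset_image)
  then have "G \<subseteq> embed_fm ` T \<union> henkin_of ` F" by auto
  with G(3) have "deriv A (henkin_lang L) (embed_fm ` T \<union> henkin_of ` F) (tconst r)"
    by (rule deriv_mono)
  then show False
    using strongly_consistent_henkin_finite[OF assms F(2,1)] r by (auto simp: strongly_consistent_def)
qed

section \<open>Maximal theories\<close>

text \<open>Zorn's lemma applies because a derivation from the union of a chain uses finitely many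
  hypotheses, all in one member.\<close>

lemma ex_maximally_strongly_consistent:
  assumes "theory_in A L T" "strongly_consistent A L T"
  shows "\<exists>S. T \<subseteq> S \<and> theory_in A L S \<and> maximally_strongly_consistent A L S"
proof -
  let ?Z = "{S. T \<subseteq> S \<and> theory_in A L S \<and> strongly_consistent A L S}"
  have "\<exists>M\<in>?Z. \<forall>X\<in>?Z. M \<subseteq> X \<longrightarrow> X = M"
  proof (rule subset_Zorn_nonempty)
    show "?Z \<noteq> {}" using assms by auto
    fix C assume C: "C \<noteq> {}" "subset.chain ?Z C"
    then have sub: "C \<subseteq> ?Z" by (auto simp: subset.chain_def)
    have "strongly_consistent A L (\<Union>C)"
      unfolding strongly_consistent_def
    proof (intro ballI notI)
      fix r assume r: "r \<in> A \<union> {1}" and d: "deriv A L (\<Union>C) (tconst r)"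
      obtain F where F: "finite F" "F \<subseteq> \<Union>C" "deriv A L F (tconst r)"
        using deriv_finite[OF d] by blast
      obtain S where "S \<in> C" "F \<subseteq> S"
        using finite_subset_Union_chain[OF F(1,2) C] by blast
      then show False
        using deriv_mono[OF F(3)] sub r by (auto simp: strongly_consistent_def)
    qed
    moreover have "theory_in A L (\<Union>C)" using sub by (auto simp: theory_in_def)
    moreover have "T \<subseteq> \<Union>C" using C(1) sub by auto
    ultimately show "\<Union>C \<in> ?Z" by simp
  qed
  then obtain M where M: "M \<in> ?Z" "\<forall>X\<in>?Z. M \<subseteq> X \<longrightarrow> X = M" by (rule bexE)
  have "\<not> strongly_consistent A L S" if "theory_in A L S" "M \<subset> S" for S
    using M(1) bspec[OF M(2), of S] that by auto
  then show ?thesis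
    using M(1) by (intro exI[of _ M]) (simp add: maximally_strongly_consistent_def)
qed

lemma maximally_strongly_consistent_refutes:
  assumes "theory_in A L T" "maximally_strongly_consistent A L T" "sentence A L \<phi>"
    and "\<not> deriv A L T \<phi>" and "r0 \<in> A"
  shows "\<exists>r\<in>A. deriv A L T (\<phi> \<^bold>\<longrightarrow> tconst r)"
proof -
  interpret theory_context A L T by unfold_locales fact
  have "theory_in A L (insert \<phi> T)" "T \<subset> insert \<phi> T"
    using assms by (auto simp: theory_in_def intro: deriv.Hyp)
  then have "\<not> strongly_consistent A L (insert \<phi> T)"
    using assms(2) by (simp add: maximally_strongly_consistent_def)
  then obtain r where r: "r \<in> A \<union> {1}" "deriv A L (insert \<phi> T) (tconst r)"
    unfolding strongly_consistent_def by blast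
  have d: "D (\<phi> \<^bold>\<longrightarrow> tconst r)" by (rule deduction) fact+
  \<comment> \<open>The derived constant may be falsity itself; it implies \<open>tconst r0\<close>,
    so a level in \<open>A\<close> can always be chosen.\<close>
  have "D (tconst 1 \<^bold>\<longrightarrow> tconst r0)" using assms(5) by (intro Axm G7) auto
  from syl[OF _ this] d r(1) assms(5) show ?thesis by auto
qed

section \<open>The maximal Henkin extension\<close>

theorem theorem3p13:
  fixes A :: "real set" and L :: "('f, 'p) lang" and T :: "('f, 'p) fm set"
  assumes "A \<subseteq> {0<..<1}" and "countable A" and "{a \<in> {0..1}. a islimpt A} = {0}"
    and "theory_in A L T" and "strongly_consistent A L T"
  shows "\<exists>(L' :: (('f, 'p) ext_names, 'p) lang) T'.
           sublang (embed_lang L) L' \<and>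
           theory_in A L' T' \<and>
           embed_fm ` T \<subseteq> T' \<and>
           maximally_strongly_consistent A L' T' \<and>
           deductively_Henkin A L' T'"
proof -
  let ?L = "henkin_lang L"
  let ?H = "embed_fm ` T \<union> henkin_of ` henkin_index A L"
  have "theory_in A ?L ?H"
    using theory_embed[OF assms(4)] sentence_henkin_of by (auto simp: theory_in_def)
  from ex_maximally_strongly_consistent[OF this strongly_consistent_henkin[OF assms(4,5)]]
  obtain S where S: "?H \<subseteq> S" "theory_in A ?L S" "maximally_strongly_consistent A ?L S"
    by blast
  have "0 islimpt A" using assms(3) by auto
  \<comment> \<open>The points of \<open>A\<close> accumulating at 0 are positive, so those close to
    0 lie below any positive bound.\<close>
  then have below: "\<exists>s\<in>A. s < e" if "e > 0" for e
    using that assms(1) by (fastforce simp: islimpt_approachable dist_real_def)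
  obtain r0 where r0: "r0 \<in> A" using below[of 1] by auto
  have "deductively_Henkin A ?L S"
    unfolding deductively_Henkin_def
  proof (intro allI impI, elim conjE)
    fix x \<phi> assume \<phi>: "sentence A ?L (All x \<phi>)" "\<not> deriv A ?L S (All x \<phi>)"
    obtain r where r: "r \<in> A" "deriv A ?L S (All x \<phi> \<^bold>\<longrightarrow> tconst r)"
      using maximally_strongly_consistent_refutes[OF S(2,3) \<phi> r0] by blast
    have "r > 0" using r(1) assms(1) by auto
    \<comment> \<open>This provides the smaller level demanded by the Henkin axiom; since
      \<open>s\<close> is in \<open>A\<close>, strong consistency forbids deriving
      \<open>tconst s\<close>.\<close>
    from below[OF this] obtain s where s: "s \<in> A" "s < r" by auto
    let ?i = "(x, \<phi>, r, s)"
    let ?c = "Inr (henkin_code ?i)"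
    have "?i \<in> henkin_index A L" using \<phi> r s by (simp add: henkin_index_def)
    then have "henkin_of ?i \<in> S" using S(1) by auto
    then have "deriv A ?L S (henkin_ax x \<phi> r s ?c)" by (auto simp: henkin_of_def intro: deriv.Hyp)
    with r(2) have d: "deriv A ?L S (subst \<phi> x (Fn ?c []) \<^bold>\<longrightarrow> tconst s)"
      unfolding henkin_ax_def by (rule deriv.MP)
    have "\<not> deriv A ?L S (tconst s)"
      using S(3) s(1) by (auto simp: maximally_strongly_consistent_def strongly_consistent_def)
    with d have "\<not> deriv A ?L S (subst \<phi> x (Fn ?c []))" using deriv.MP by blast
    then show "\<exists>c. (c, 0) \<in> Funs ?L \<and> \<not> deriv A ?L S (subst \<phi> x (Fn c []))"
      by (intro exI[of _ ?c]) simp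
  qed
  moreover have "sublang (embed_lang L) ?L"
    by (auto simp: sublang_def henkin_lang_def embed_lang_def)
  ultimately show ?thesis
    using S by (intro exI[of _ ?L] exI[of _ S]) auto
qed

end
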